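(* Let $G$ be a topological group which contains a separable compact subgroup $K$ such that the quotient space $G/K$ is countable. Then $G$ is $S$-separable.
   Context: All topological groups are assumed to be Hausdorff. A space is separable if it contains a countable dense subset; subgroups carry the subspace topology. $K$ is not assumed normal in $G$; $G/K$ is the space of left cosets. A topological group $G$ is called $S$-separable (strongly separable) if for every topological group $H$ such that every closed subgroup of $H$ is separable, every closed subgroup of the product group $G\times H$ is separable. *)

theory Defs
  imports "HOL-Analysis.Analysis" "HOL-Algebra.Left_Coset"
begin

text \<open>Hausdorff topological groups, given by a group and a topology on its carrier.\<close>

definition topological_group :: "('a, 'm) monoid_scheme \<Rightarrow> 'a topology \<Rightarrow> bool" where
  "topological_group G T \<longleftrightarrow>
     group G \<and>
     topspace T = carrier G \<and>
     Hausdorff_space T \<and>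
     continuous_map (prod_topology T T) T (\<lambda>(x, y). x \<otimes>\<^bsub>G\<^esub> y) \<and>
     continuous_map T T (\<lambda>x. inv\<^bsub>G\<^esub> x)"

definition closed_subgroups_separable :: "('a, 'm) monoid_scheme \<Rightarrow> 'a topology \<Rightarrow> bool" where
  "closed_subgroups_separable G T \<longleftrightarrow>
     (\<forall>S. subgroup S G \<and> closedin T S \<longrightarrow> separable_space (subtopology T S))"

text \<open>
  HOL cannot quantify over types inside a formula, so the element type \<open>'h\<close> of the test
  groups \<open>H\<close> is an explicit parameter. A theorem that concludes \<open>S_separable TYPE('h) G T\<close>
  with \<open>'h\<close> an unconstrained type variable covers the test groups over every type.
\<close>

definition S_separable ::
    "'h itself \<Rightarrow> ('a, 'm) monoid_scheme \<Rightarrow> 'a topology \<Rightarrow> bool" where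
  "S_separable _ G T \<longleftrightarrow>
     topological_group G T \<and>
     (\<forall>(H :: 'h monoid) U.
        topological_group H U \<and> closed_subgroups_separable H U \<longrightarrow>
        closed_subgroups_separable (G \<times>\<times> H) (prod_topology T U))"

end

theory Submission
  imports Defs
begin

text \<open>A closed subgroup \<open>S\<close> of \<open>G \<times> H\<close> is covered by countably many translates of
  \<open>S\<^sub>0 = S \<inter> (K \<times> H)\<close>. The projection of \<open>S\<^sub>0\<close> to \<open>H\<close> is closed, with closed image and with kernel a
  closed subgroup of \<open>K\<close>, so it remains to show that closed subgroups of a separable compact group
  are separable. Such a group \<open>M\<close> has a base indexed by sets of naturals, hence a family \<open>N\<^sub>i\<close> of closed
  subgroups with trivial intersection and second countable quotients \<open>M / N\<^sub>i\<close>, indexed by at most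
  continuum many \<open>i\<close>. Well-order the indices. A function \<open>t\<close> from indices to \<open>\<nat>\<close> determines a point of
  \<open>M\<close> by transfinite recursion: at stage \<open>i\<close> the coset of the intersection of the \<open>N\<^sub>j\<close> with \<open>j < i\<close>
  reached so far is refined by a coset of \<open>N\<^sub>i\<close> meeting the basic open set of \<open>M / N\<^sub>i\<close> with number \<open>t i\<close>, if possible. By compactness, membership in a
  given nonempty open set is forced by finitely many values of \<open>t\<close>, and, as in the theorem of Hewitt,
  Marczewski and Pondiczery, countably many \<open>t\<close> realise all finite patterns.\<close>

no_notation subset_mset (infix \<open><#\<close> 50)
no_notation eq_closure_of (\<open>closure'_of\<index>\<close>)

section \<open>Hausdorff groups\<close>

locale hausdorff_group =
  fixes G (structure) and T
  assumes topological_group: "topological_group G T"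
begin

sublocale group G
  using topological_group by (simp add: topological_group_def)

lemma topspace_eq [simp]: "topspace T = carrier G"
  and Hausdorff: "Hausdorff_space T"
  and continuous_mult: "continuous_map (prod_topology T T) T (\<lambda>(x, y). x \<otimes> y)"
  and continuous_inv: "continuous_map T T (\<lambda>x. inv x)"
  using topological_group by (auto simp: topological_group_def)

lemma openin_carrier_self [simp]: "openin T (carrier G)"
  and closedin_carrier_self [simp]: "closedin T (carrier G)"
  by (metis openin_topspace topspace_eq, metis closedin_topspace topspace_eq)

lemma continuous_map_mult [continuous_intros]:
  assumes "continuous_map X T f" "continuous_map X T g"
  shows "continuous_map X T (\<lambda>x. f x \<otimes> g x)"
proof -
  have "continuous_map X T ((\<lambda>(x, y). x \<otimes> y) \<circ> (\<lambda>x. (f x, g x)))"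
    using assms by (intro continuous_map_compose[OF _ continuous_mult]) (simp add: continuous_map_pairedI)
  then show ?thesis by (simp add: o_def)
qed

lemma openin_carrier: "openin T U \<Longrightarrow> U \<subseteq> carrier G"
  using openin_subset by fastforce

lemma mem_l_coset_iff:
  assumes "x \<in> carrier G" "N \<subseteq> carrier G"
  shows "y \<in> x <# N \<longleftrightarrow> y \<in> carrier G \<and> inv x \<otimes> y \<in> N"
proof
  assume "y \<in> x <# N"
  then obtain n where n: "n \<in> N" "y = x \<otimes> n" by (auto simp: l_coset_def)
  then show "y \<in> carrier G \<and> inv x \<otimes> y \<in> N"
    using assms by (auto simp: subset_iff m_assoc[symmetric])
next
  assume *: "y \<in> carrier G \<and> inv x \<otimes> y \<in> N"
  then have "y = x \<otimes> (inv x \<otimes> y)" using assms by (simp add: m_assoc[symmetric])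
  then show "y \<in> x <# N" using * by (auto simp: l_coset_def)
qed

lemma continuous_l_translation:
  assumes "x \<in> carrier G" shows "continuous_map T T (\<lambda>y. x \<otimes> y)"
  using assms by (intro continuous_map_mult) auto

lemma continuous_r_translation:
  assumes "x \<in> carrier G" shows "continuous_map T T (\<lambda>y. y \<otimes> x)"
  using assms by (intro continuous_map_mult) auto

lemma l_coset_eq_preimage:
  assumes "x \<in> carrier G" "N \<subseteq> carrier G"
  shows "x <# N = {y \<in> topspace T. inv x \<otimes> y \<in> N}"
  using mem_l_coset_iff[OF assms] by auto

lemma openin_l_coset:
  assumes "x \<in> carrier G" "openin T U" shows "openin T (x <# U)"
  using assms openin_carrier[OF assms(2)]
  by (simp only: l_coset_eq_preimage) (intro openin_continuous_map_preimage[OF continuous_l_translation], auto)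

lemma closedin_l_coset:
  assumes "x \<in> carrier G" "closedin T F" shows "closedin T (x <# F)"
proof -
  have "F \<subseteq> carrier G" using closedin_subset[OF assms(2)] by simp
  with assms show ?thesis
    by (simp only: l_coset_eq_preimage) (intro closedin_continuous_map_preimage[OF continuous_l_translation], auto)
qed

lemma openin_set_mult:
  assumes "openin T U" "A \<subseteq> carrier G" shows "openin T (U <#> A)"
proof -
  have "U <#> A = (\<Union>a\<in>A. {y \<in> topspace T. y \<otimes> inv a \<in> U})"
  proof (intro equalityI subsetI)
    fix y assume "y \<in> U <#> A"
    then obtain u a where "u \<in> U" "a \<in> A" "y = u \<otimes> a" by (auto simp: set_mult_def)
    moreover then have "u \<in> carrier G" "a \<in> carrier G" using assms openin_carrier by blast+
    ultimately show "y \<in> (\<Union>a\<in>A. {y \<in> topspace T. y \<otimes> inv a \<in> U})"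
      by (auto simp: m_assoc intro!: bexI[of _ a])
  next
    fix y assume "y \<in> (\<Union>a\<in>A. {y \<in> topspace T. y \<otimes> inv a \<in> U})"
    then obtain a where a: "a \<in> A" "y \<in> carrier G" "y \<otimes> inv a \<in> U" by auto
    moreover then have "y = (y \<otimes> inv a) \<otimes> a" using assms by (simp add: m_assoc subset_iff)
    ultimately show "y \<in> U <#> A" by (auto simp: set_mult_def)
  qed
  moreover have "openin T {y \<in> topspace T. y \<otimes> inv a \<in> U}" if "a \<in> A" for a
    using assms that by (intro openin_continuous_map_preimage[OF continuous_r_translation]) auto
  ultimately show ?thesis by auto
qed

text \<open>This is the tube lemma: the bad pairs \<open>(x, a)\<close> with
  \<open>x \<otimes> a\<close> outside \<open>U\<close> form a closed subset of \<open>T\<close>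
  times the compact set \<open>A\<close>, and projecting along a compact factor is a closed
  map.\<close>

lemma openin_l_cosets_inside:
  assumes "compactin T A" "openin T U"
  shows "openin T {x \<in> carrier G. x <# A \<subseteq> U}"
proof -
  let ?X = "prod_topology T (subtopology T A)"
  have A: "A \<subseteq> carrier G" using assms(1) compactin_subset_topspace by fastforce
  define F where "F = {p \<in> topspace ?X. fst p \<otimes> snd p \<in> carrier G - U}"
  have "continuous_map ?X T (\<lambda>p. fst p \<otimes> snd p)"
    using continuous_map_into_fulltopology[OF continuous_map_snd[of T "subtopology T A"]]
    by (intro continuous_map_mult continuous_map_fst)
  then have "closedin ?X F"
    unfolding F_def using assms(2)
    by (intro closedin_continuous_map_preimage) auto
  then have "closedin T (fst ` F)"
    using closed_map_fst[OF compact_space_subtopology[OF assms(1)], of T] by (auto simp: closed_map_def)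
  moreover have "{x \<in> carrier G. x <# A \<subseteq> U} = topspace T - fst ` F"
    using A by (force simp: F_def l_coset_def image_iff)
  ultimately show ?thesis by (simp add: openin_diff)
qed

end

section \<open>Auxiliary facts: finite maxima, separation of closed sets, interpolation\<close>

lemma finite_total_trans_has_greatest:
  assumes "finite J" "J \<noteq> {}" "trans r" "total r"
  shows "\<exists>m\<in>J. \<forall>j\<in>J. j = m \<or> (j, m) \<in> r"
  using assms(1,2)
proof (induction J rule: finite_ne_induct)
  case (insert x J)
  then obtain m where m: "m \<in> J" "\<forall>j\<in>J. j = m \<or> (j, m) \<in> r" by blast
  show ?case
  proof (cases "(m, x) \<in> r")
    case True
    then have "\<forall>j\<in>J. (j, x) \<in> r" using m(2) transD[OF \<open>trans r\<close>, of _ m x] by auto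
    then show ?thesis by blast
  next
    case False
    then have "x = m \<or> (x, m) \<in> r" using \<open>total r\<close> by (auto simp: total_on_def)
    then show ?thesis using m by blast
  qed
qed auto

text \<open>The closed sets \<open>A - U\<close> and \<open>B - U\<close> are disjoint, so normality
  separates them; adding \<open>U\<close> back to both neighbourhoods changes their intersection
  only inside \<open>U\<close>.\<close>

lemma closedin_pair_Int_separation:
  assumes "normal_space X" "closedin X A" "closedin X B" "openin X U" "A \<inter> B \<subseteq> U"
  obtains P Q where "openin X P" "openin X Q" "A \<subseteq> P" "B \<subseteq> Q" "P \<inter> Q \<subseteq> U"
proof -
  have "closedin X (A - U)" "closedin X (B - U)" "disjnt (A - U) (B - U)"
    using assms by (auto simp: disjnt_iff)
  then obtain P Q where PQ: "openin X P" "openin X Q" "A - U \<subseteq> P" "B - U \<subseteq> Q" "disjnt P Q"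
    using \<open>normal_space X\<close> unfolding normal_space_def by meson
  show thesis
    by (rule that[of "P \<union> U" "Q \<union> U"]) (use PQ assms in \<open>auto simp: disjnt_iff\<close>)
qed

text \<open>A set of natural numbers is recognised among finitely many others by its trace on an initial
  segment, so the functions reading off a finite table indexed by traces suffice.\<close>

lemma countable_interpolating_functions:
  "\<exists>S :: (nat set \<Rightarrow> nat) set. countable S \<and> (\<forall>F n. finite F \<longrightarrow> (\<exists>t\<in>S. \<forall>A\<in>F. t A = n A))"
proof -
  define code where "code k A = set_encode (A \<inter> {..<k})" for k A
  define f where "f = (\<lambda>(k, xs) A. xs ! code k A :: nat)"
  have "\<exists>t\<in>range f. \<forall>A\<in>F. t A = n A" if "finite F" for F n
  proof -
    define d where "d A B = (SOME x. x \<in> A \<longleftrightarrow> x \<notin> B)" for A B :: "nat set"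
    have d: "d A B \<in> A \<longleftrightarrow> d A B \<notin> B" if "A \<noteq> B" for A B
    proof -
      have "\<exists>x. x \<in> A \<longleftrightarrow> x \<notin> B" using that by blast
      then show ?thesis unfolding d_def by (rule someI_ex)
    qed
    \<comment> \<open>Beyond one distinguishing number for every pair from \<open>F\<close>, so that
      the traces below \<open>k\<close> already tell the members of \<open>F\<close> apart.\<close>
    obtain k where k: "\<forall>x\<in>(\<lambda>(A, B). d A B) ` (F \<times> F). x < k"
      using \<open>finite F\<close> finite_nat_set_iff_bounded[of "(\<lambda>(A, B). d A B) ` (F \<times> F)"] by auto
    have inj: "inj_on (code k) F"
    proof (rule inj_onI, rule ccontr)
      fix A B assume AB: "A \<in> F" "B \<in> F" "code k A = code k B" "A \<noteq> B"
      have "A \<inter> {..<k} = B \<inter> {..<k}"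
        using arg_cong[OF AB(3), of set_decode] by (simp add: code_def)
      moreover have "d A B < k" using k AB by auto
      ultimately show False using d[OF AB(4)] by blast
    qed
    obtain M where M: "\<forall>x\<in>code k ` F. x < M"
      using \<open>finite F\<close> finite_nat_set_iff_bounded[of "code k ` F"] by auto
    \<comment> \<open>The table stores \<open>n A\<close> at position \<open>code k A\<close>;
      injectivity of \<open>code k\<close> on \<open>F\<close> makes this consistent.\<close>
    define xs where "xs = map (\<lambda>s. n (inv_into F (code k) s)) [0..<M]"
    have "f (k, xs) A = n A" if "A \<in> F" for A
      using that M inj by (simp add: f_def xs_def)
    then show ?thesis by blast
  qed
  then show ?thesis by (intro exI[of _ "range f"]) auto
qed

section \<open>Points determined by transfinite choices of cosets\<close>

text \<open>\<open>B_shrinks\<close> expresses second countability of the coset space of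
  \<open>N i\<close> without forming the quotient: every open set containing a whole coset of
  \<open>N i\<close> contains some \<open>B i n\<close> around the chosen representative. The
  relation \<open>r\<close> is a strict well-order.\<close>

locale subgroup_tower = hausdorff_group +
  fixes r :: "'i rel" and N :: "'i \<Rightarrow> 'a set" and B :: "'i \<Rightarrow> nat \<Rightarrow> 'a set"
  assumes compact: "compact_space T"
    and wf_r: "wf r" and trans_r: "trans r" and total_r: "total r"
    and subgroup_N: "\<And>i. subgroup (N i) G" and closedin_N: "\<And>i. closedin T (N i)"
    and openin_B: "\<And>i n. openin T (B i n)"
    and B_shrinks: "\<And>i x U. \<lbrakk>x \<in> carrier G; openin T U; x <# N i \<subseteq> U\<rbrakk> \<Longrightarrow> \<exists>n. x \<in> B i n \<and> B i n \<subseteq> U"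
begin

section \<open>Initial segments, partial intersections and the recursion rule\<close>

definition below :: "'i \<Rightarrow> 'i set" where
  "below i = {j. (j, i) \<in> r}"

definition downset :: "'i set \<Rightarrow> bool" where
  "downset D \<longleftrightarrow> (\<forall>i\<in>D. below i \<subseteq> D)"

definition L :: "'i set \<Rightarrow> 'a set" where
  "L D = {x \<in> carrier G. \<forall>j\<in>D. x \<in> N j}"

definition C :: "('i \<Rightarrow> 'a) \<Rightarrow> 'i set \<Rightarrow> 'a set" where
  "C c D = {y \<in> carrier G. \<forall>j\<in>D. y \<in> c j <# N j}"

text \<open>The rule for stage \<open>i\<close> of the recursion: stay in the coset reached so far
  and enter \<open>B i (t i)\<close> if that coset meets it. Otherwise any point of the coset is
  allowed, so a bad value of \<open>t\<close> never blocks the recursion.\<close>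

definition guided :: "('i \<Rightarrow> nat) \<Rightarrow> ('i \<Rightarrow> 'a) \<Rightarrow> 'i \<Rightarrow> 'a \<Rightarrow> bool" where
  "guided t c i y \<longleftrightarrow>
     y \<in> C c (below i) \<and> (C c (below i) \<inter> B i (t i) \<noteq> {} \<longrightarrow> y \<in> B i (t i))"

text \<open>A forcing property: finitely many values of \<open>t\<close> guarantee membership in
  \<open>U\<close>, whatever free choices \<open>c\<close> makes. Requiring
  \<open>F \<subseteq> D\<close> leaves the values at stages outside \<open>D\<close> free to be
  prescribed later in the induction.\<close>

definition hits :: "'i set \<Rightarrow> bool" where
  "hits D \<longleftrightarrow> (\<forall>x\<in>carrier G. \<forall>U. openin T U \<and> x <# L D \<subseteq> U \<longrightarrow>
     (\<exists>F n. finite F \<and> F \<subseteq> D \<and>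
       (\<forall>t c. (\<forall>i. guided t c i (c i)) \<and> (\<forall>j\<in>F. t j = n j) \<longrightarrow> C c D \<subseteq> U)))"

lemma hitsD:
  assumes "hits D" "x \<in> carrier G" "openin T U" "x <# L D \<subseteq> U"
  shows "\<exists>F n. finite F \<and> F \<subseteq> D \<and>
    (\<forall>t c. (\<forall>i. guided t c i (c i)) \<and> (\<forall>j\<in>F. t j = n j) \<longrightarrow> C c D \<subseteq> U)"
  using assms unfolding hits_def by simp

lemma N_carrier: "N i \<subseteq> carrier G"
  using subgroup_N subgroup.subset by blast

lemma subgroup_L: "subgroup (L D) G"
proof (rule subgroupI)
  show "L D \<noteq> {}" using subgroup.one_closed[OF subgroup_N] by (auto simp: L_def)
qed (auto simp: L_def subgroup.m_closed[OF subgroup_N] subgroup.m_inv_closed[OF subgroup_N])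

lemma closedin_L: "closedin T (L D)"
proof -
  have "L D = \<Inter>(insert (carrier G) (N ` D))" by (auto simp: L_def)
  moreover have "closedin T (\<Inter>(insert (carrier G) (N ` D)))"
    using closedin_N by (intro closedin_Inter) auto
  ultimately show ?thesis by (simp only:)
qed

lemma L_carrier: "L D \<subseteq> carrier G"
  by (auto simp: L_def)

lemma coset_L_eq:
  assumes "x \<in> carrier G" shows "x <# L D = {y \<in> carrier G. \<forall>j\<in>D. y \<in> x <# N j}"
  using assms by (auto simp: mem_l_coset_iff L_carrier N_carrier) (auto simp: L_def)

text \<open>Any common point of the chosen cosets represents all of them, and the intersection of
  the cosets through one point is a coset of the intersection.\<close>

lemma C_eq_coset:
  assumes "x \<in> C c D" "\<And>j. j \<in> D \<Longrightarrow> c j \<in> carrier G"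
  shows "C c D = x <# L D"
proof -
  have "x \<in> carrier G" using assms by (auto simp: C_def)
  moreover have "c j <# N j = x <# N j" if "j \<in> D" for j
    using assms that by (intro l_repr_independence subgroup_N) (auto simp: C_def)
  ultimately show ?thesis by (auto simp: coset_L_eq C_def)
qed

text \<open>By compactness finitely many cosets suffice. If \<open>m\<close> is the greatest index
  involved, then \<open>c m\<close> lies in its own coset and, by assumption, in those of all
  smaller indices.\<close>

lemma C_nonempty:
  assumes "downset D" and c: "\<And>m. m \<in> D \<Longrightarrow> c m \<in> C c (below m)"
  shows "C c D \<noteq> {}"
proof -
  have car: "c m \<in> carrier G" if "m \<in> D" for m using c[OF that] by (simp add: C_def)
  \<comment> \<open>With \<open>carrier G\<close> included, the intersection is \<open>C c D\<close>
    even for empty \<open>D\<close>.\<close>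
  define \<U> where "\<U> = insert (carrier G) ((\<lambda>j. c j <# N j) ` D)"
  have "\<Inter>\<F> \<noteq> {}" if "finite \<F>" "\<F> \<subseteq> \<U>" for \<F>
  proof -
    have "\<F> - {carrier G} \<subseteq> (\<lambda>j. c j <# N j) ` D" using that by (auto simp: \<U>_def)
    from finite_subset_image[OF finite_Diff[OF that(1)] this]
    obtain J where J: "J \<subseteq> D" "finite J" "\<F> - {carrier G} = (\<lambda>j. c j <# N j) ` J"
      by blast
    show ?thesis
    proof (cases "J = {}")
      case True
      then have "\<one> \<in> \<Inter>\<F>" using J by auto
      then show ?thesis by blast
    next
      case False
      then obtain m where m: "m \<in> J" "\<forall>j\<in>J. j = m \<or> (j, m) \<in> r"
        using finite_total_trans_has_greatest J trans_r total_r by metis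
      have cm: "c m \<in> c j <# N j" if "j \<in> J" for j
      proof (cases "j = m")
        case True
        then show ?thesis using lcos_self[OF car subgroup_N] m(1) J(1) by blast
      next
        case False
        then show ?thesis using c[of m] m J that by (auto simp: C_def below_def)
      qed
      have "c m \<in> S" if "S \<in> \<F>" for S
      proof (cases "S = carrier G")
        case True
        then show ?thesis using car m(1) J(1) by blast
      next
        case False
        then have "S \<in> (\<lambda>j. c j <# N j) ` J" using that J(3) by blast
        then show ?thesis using cm by blast
      qed
      then show ?thesis by blast
    qed
  qed
  moreover have "closedin T S" if "S \<in> \<U>" for S
    using that closedin_l_coset closedin_N car by (auto simp: \<U>_def)
  ultimately have "\<Inter>\<U> \<noteq> {}" using compact unfolding compact_space_fip by meson
  then show ?thesis by (auto simp: \<U>_def C_def)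
qed

section \<open>Existence of guided choices and forcing by finitely many values\<close>

lemma downset_below: "downset (below i)"
  using trans_r by (auto simp: downset_def below_def dest: transD)

text \<open>Well-founded dependent choice applies because the condition at \<open>i\<close> reads
  only earlier values of \<open>c\<close>, and \<open>C_nonempty\<close> keeps the coset reached
  before \<open>i\<close> nonempty.\<close>

lemma exists_guided: "\<exists>c. \<forall>i. guided t c i (c i)"
proof (rule dependent_wf_choice[OF wf_r])
  fix f g :: "'i \<Rightarrow> 'a" and i y
  assume "\<And>z. (z, i) \<in> r \<Longrightarrow> f z = g z"
  then have "C f (below i) = C g (below i)" by (auto simp: C_def below_def)
  then show "guided t f i y = guided t g i y" by (simp add: guided_def)
next
  fix i f assume "\<And>j. (j, i) \<in> r \<Longrightarrow> guided t f j (f j)"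
  then have "C f (below i) \<noteq> {}"
    by (intro C_nonempty downset_below) (auto simp: guided_def below_def)
  then show "\<exists>y. guided t f i y" by (auto simp: guided_def)
qed

text \<open>By compactness finitely many of the cosets \<open>x <# N j\<close> already intersect
  inside \<open>U\<close>; their greatest index serves as \<open>m\<close>. If none is needed,
  \<open>U\<close> is everything and any element of \<open>D\<close> will do.\<close>

lemma coset_L_below_inside:
  assumes "downset D" "x \<in> carrier G" "openin T U" "x <# L D \<subseteq> U" "D \<noteq> {}"
  shows "\<exists>m\<in>D. x <# L (insert m (below m)) \<subseteq> U"
proof -
  define \<U> where "\<U> = insert (carrier G - U) ((\<lambda>j. x <# N j) ` D)"
  have "\<Inter>\<U> = {}" using assms by (auto simp: \<U>_def coset_L_eq)
  moreover have "closedin T S" if "S \<in> \<U>" for S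
    using that closedin_l_coset closedin_N assms by (auto simp: \<U>_def)
  ultimately obtain \<F> where F: "finite \<F>" "\<F> \<subseteq> \<U>" "\<Inter>\<F> = {}"
    using compact unfolding compact_space_fip by meson
  then have "\<F> - {carrier G - U} \<subseteq> (\<lambda>j. x <# N j) ` D" by (auto simp: \<U>_def)
  from finite_subset_image[OF finite_Diff[OF F(1)] this]
  obtain J where J: "J \<subseteq> D" "finite J" "\<F> - {carrier G - U} = (\<lambda>j. x <# N j) ` J"
    by blast
  have sub: "{y \<in> carrier G. \<forall>j\<in>J. y \<in> x <# N j} \<subseteq> U"
  proof
    fix y assume y: "y \<in> {y \<in> carrier G. \<forall>j\<in>J. y \<in> x <# N j}"
    show "y \<in> U"
    proof (rule ccontr)
      assume "y \<notin> U"
      have "y \<in> S" if "S \<in> \<F>" for S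
      proof (cases "S = carrier G - U")
        case True
        then show ?thesis using y \<open>y \<notin> U\<close> by blast
      next
        case False
        then have "S \<in> (\<lambda>j. x <# N j) ` J" using that J(3) by blast
        then show ?thesis using y by blast
      qed
      then show False using F(3) by blast
    qed
  qed
  show ?thesis
  proof (cases "J = {}")
    case True
    then have "carrier G \<subseteq> U" using sub by simp
    then show ?thesis using \<open>D \<noteq> {}\<close> assms(2) by (auto simp: coset_L_eq)
  next
    case False
    then obtain m where m: "m \<in> J" "\<forall>j\<in>J. j = m \<or> (j, m) \<in> r"
      using finite_total_trans_has_greatest J trans_r total_r by metis
    then have "x <# L (insert m (below m)) \<subseteq> {y \<in> carrier G. \<forall>j\<in>J. y \<in> x <# N j}"
      unfolding coset_L_eq[OF assms(2)] below_def by blast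
    then show ?thesis using J(1) m(1) sub by blast
  qed
qed

text \<open>The task is reduced to a single stage \<open>m\<close>. The induction hypothesis for
  \<open>below m\<close> makes the coset reached before \<open>m\<close> meet a suitable
  \<open>B m k\<close>; the one further value \<open>t m = k\<close> then steers \<open>c m\<close>
  into it, and this settles membership in \<open>U\<close>.\<close>

lemma hits_step:
  assumes D: "downset D" and IH: "\<And>m. m \<in> D \<Longrightarrow> hits (below m)"
  shows "hits D"
  unfolding hits_def
proof (intro ballI allI impI)
  fix x U assume x: "x \<in> carrier G" and U: "openin T U \<and> x <# L D \<subseteq> U"
  show "\<exists>F n. finite F \<and> F \<subseteq> D \<and>
       (\<forall>t c. (\<forall>i. guided t c i (c i)) \<and> (\<forall>j\<in>F. t j = n j) \<longrightarrow> C c D \<subseteq> U)"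
  proof (cases "D = {}")
    case True
    then have "C c D \<subseteq> U" for c using U x by (auto simp: C_def coset_L_eq)
    then show ?thesis by auto
  next
    case False
    then obtain m where m: "m \<in> D" "x <# L (insert m (below m)) \<subseteq> U"
      using coset_L_below_inside D x U by blast
    let ?M = "L (insert m (below m))"
    \<comment> \<open>The points whose full coset of \<open>?M\<close> lies in \<open>U\<close>. It
      is enough to force \<open>c m\<close> into \<open>U'\<close>, since \<open>C c D\<close> is
      contained in the coset \<open>c m <# ?M\<close>.\<close>
    define U' where "U' = {y \<in> carrier G. y <# ?M \<subseteq> U}"
    have "openin T U'"
      unfolding U'_def using U compact closedin_L
      by (intro openin_l_cosets_inside) (auto simp: closedin_compact_space)
    moreover have "x <# ?M \<subseteq> U'"
    proof
      fix y assume y: "y \<in> x <# ?M"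
      then have "y <# ?M = x <# ?M" using l_repr_independence x subgroup_L by metis
      moreover have "y \<in> carrier G" using y x L_carrier by (simp add: mem_l_coset_iff)
      ultimately show "y \<in> U'" using m by (simp add: U'_def)
    qed
    then have "(x <# L (below m)) \<inter> (x <# N m) \<subseteq> U'"
      using x by (auto simp: coset_L_eq)
    moreover have "normal_space T"
      using compact Hausdorff compact_Hausdorff_or_regular_imp_normal_space by blast
    \<comment> \<open>The coset of \<open>?M\<close> is the intersection of a coset for the earlier
      stages and a coset of \<open>N m\<close>. Separating the two splits the goal into
      \<open>P\<close>, left to the earlier stages, and \<open>Q\<close>, left to stage
      \<open>m\<close>.\<close>
    ultimately obtain P Q where PQ: "openin T P" "openin T Q" "x <# L (below m) \<subseteq> P"
        "x <# N m \<subseteq> Q" "P \<inter> Q \<subseteq> U'"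
      using closedin_pair_Int_separation[of T "x <# L (below m)" "x <# N m" U'] closedin_l_coset x
        closedin_L closedin_N by metis
    obtain k where k: "x \<in> B m k" "B m k \<subseteq> Q" using B_shrinks PQ x by metis
    \<comment> \<open>The second factor ensures that a coset of \<open>L (below m)\<close> with a
      point in \<open>V\<close> meets \<open>B m k\<close>, which is what \<open>guided\<close> asks
      for before entering \<open>B m k\<close>.\<close>
    define V where "V = P \<inter> (B m k <#> L (below m))"
    have "openin T V" unfolding V_def using PQ openin_B L_carrier by (intro openin_Int openin_set_mult)
    moreover have "x <# L (below m) \<subseteq> V"
      using PQ(3) k(1) by (auto simp: V_def l_coset_def set_mult_def)
    ultimately obtain F n where F: "finite F" "F \<subseteq> below m"
      and hit: "\<forall>t c. (\<forall>i. guided t c i (c i)) \<and> (\<forall>j\<in>F. t j = n j) \<longrightarrow> C c (below m) \<subseteq> V"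
      using hitsD[OF IH[OF m(1)] x, of V] by auto
    have CU: "C c D \<subseteq> U" if g: "\<forall>i. guided t c i (c i)" and t: "\<forall>j\<in>insert m F. t j = (n(m := k)) j" for t c
    proof -
      have car: "c j \<in> carrier G" for j using g by (auto simp: guided_def C_def)
      \<comment> \<open>The stages in \<open>F\<close> precede \<open>m\<close>, so prescribing
        \<open>k\<close> at \<open>m\<close> does not disturb the pattern \<open>n\<close> on
        \<open>F\<close>.\<close>
      have "m \<notin> F" using F(2) wf_not_refl[OF wf_r] by (auto simp: below_def)
      then have "\<forall>j\<in>F. t j = n j" using t by auto
      then have "C c (below m) \<subseteq> V" using hit g by simp
      moreover have cm: "c m \<in> C c (below m)" using g by (simp add: guided_def)
      then have Cm: "C c (below m) = c m <# L (below m)" using C_eq_coset car by blast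
      ultimately have "c m \<in> P" "c m \<in> B m k <#> L (below m)" using cm by (auto simp: V_def)
      then obtain w l where wl: "w \<in> B m k" "l \<in> L (below m)" "c m = w \<otimes> l"
        by (auto simp: set_mult_def)
      have "w \<in> carrier G" using wl(1) openin_B openin_carrier by blast
      moreover have "l \<in> carrier G" using wl(2) L_carrier by blast
      ultimately have "inv (c m) \<otimes> w = inv l" using wl(3)
        by (simp add: inv_mult_group m_assoc)
      \<comment> \<open>The point \<open>w\<close> differs from \<open>c m\<close> by an element of
        \<open>L (below m)\<close>, so it witnesses that the coset reached before \<open>m\<close>
        meets \<open>B m k\<close>.\<close>
      then have "w \<in> C c (below m)"
        using Cm wl(2) car \<open>w \<in> carrier G\<close> subgroup.m_inv_closed[OF subgroup_L]
        by (simp add: mem_l_coset_iff L_carrier)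
      then have "c m \<in> B m k" using g wl(1) t by (auto simp: guided_def)
      then have "c m \<in> U'" using \<open>c m \<in> P\<close> PQ k by blast
      moreover have "C c D \<subseteq> c m <# ?M"
      proof -
        have "C c D \<subseteq> C c (below m) \<inter> (c m <# N m)"
          using D m(1) by (auto simp: C_def downset_def)
        then show ?thesis using Cm car by (auto simp: coset_L_eq)
      qed
      ultimately show ?thesis by (auto simp: U'_def)
    qed
    show ?thesis
    proof (intro exI conjI allI impI)
      show "finite (insert m F)" "insert m F \<subseteq> D"
        using F m(1) D by (auto simp: downset_def)
      show "C c D \<subseteq> U" if "(\<forall>i. guided t c i (c i)) \<and> (\<forall>j\<in>insert m F. t j = (n(m := k)) j)" for t c
        using that by (intro CU) blast+
    qed
  qed
qed

lemma hits_UNIV: "hits UNIV"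
proof -
  have "hits (below i)" for i
  proof (induction i rule: wf_induct_rule[OF wf_r])
    case (1 i)
    show ?case by (rule hits_step[OF downset_below]) (rule 1, simp add: below_def)
  qed
  then show ?thesis by (rule hits_step[rotated]) (simp_all add: downset_def)
qed

end

text \<open>When the subgroups intersect trivially, \<open>hits UNIV\<close> applies to every
  neighbourhood of every point. The injection \<open>e\<close> lets the countable interpolating
  family realise all finite patterns on the index set, and one point for each member of that family
  gives a dense set.\<close>

lemma (in subgroup_tower) separable_if_trivial_intersection:
  fixes e :: "'i \<Rightarrow> nat set"
  assumes "inj e" and triv: "(\<Inter>i. N i) \<subseteq> {\<one>}"
  shows "separable_space T"
proof -
  obtain S :: "(nat set \<Rightarrow> nat) set"
    where S: "countable S" "\<forall>F n. finite F \<longrightarrow> (\<exists>t\<in>S. \<forall>A\<in>F. t A = n A)"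
    using countable_interpolating_functions by auto
  obtain c where c: "\<And>t i. guided t (c t) i (c t i)" using exists_guided by metis
  have "\<exists>y. y \<in> C (c t) UNIV" for t
    using C_nonempty[of UNIV "c t"] c by (auto simp: downset_def guided_def)
  then obtain p where p: "\<And>t. p t \<in> C (c t) UNIV" by metis
  define E where "E = (\<lambda>t. p (t \<circ> e)) ` S"
  have "E \<subseteq> carrier G" using p by (auto simp: E_def C_def)
  moreover have "\<exists>y\<in>E. y \<in> U" if U: "openin T U" "x \<in> U" for U x
  proof -
    have x: "x \<in> carrier G" using U openin_carrier by blast
    have "L UNIV \<subseteq> {\<one>}" using triv by (auto simp: L_def)
    then have "x <# L UNIV \<subseteq> U" using x U by (auto simp: l_coset_def)
    then obtain F n where F: "finite F" "F \<subseteq> UNIV"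
      and hit: "\<forall>t c. (\<forall>i. guided t c i (c i)) \<and> (\<forall>j\<in>F. t j = n j) \<longrightarrow> C c UNIV \<subseteq> U"
      using hitsD[OF hits_UNIV x U(1)] by auto
    \<comment> \<open>The pattern \<open>n\<close> on \<open>F\<close> is carried along
      \<open>e\<close> to a pattern on finitely many sets of naturals.\<close>
    obtain t where "t \<in> S" and t: "\<forall>A\<in>e ` F. t A = (n \<circ> Hilbert_Choice.inv e) A"
      using S(2)[rule_format, OF finite_imageI[OF F(1), of e], of "n \<circ> Hilbert_Choice.inv e"] by auto
    have "\<forall>j\<in>F. (t \<circ> e) j = n j" using t \<open>inj e\<close> by simp
    then have "C (c (t \<circ> e)) UNIV \<subseteq> U" using hit c by blast
    then show ?thesis using p \<open>t \<in> S\<close> by (auto simp: E_def)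
  qed
  ultimately have "T closure_of E = topspace T"
    by (auto simp: closure_of_def)
  then show ?thesis
    unfolding separable_space_def using S(1) \<open>E \<subseteq> carrier G\<close> by (intro exI[of _ E]) (auto simp: E_def)
qed

section \<open>Closed subgroups of separable compact groups\<close>

text \<open>Density is tested with open sets of the ambient space, so that later arguments can
  translate open sets of the whole group.\<close>

lemma separable_subtopology_iff:
  assumes "S \<subseteq> topspace X"
  shows "separable_space (subtopology X S) \<longleftrightarrow>
    (\<exists>D. countable D \<and> D \<subseteq> S \<and> (\<forall>U x. openin X U \<and> x \<in> U \<inter> S \<longrightarrow> (\<exists>y\<in>D. y \<in> U)))"
proof -
  have S: "topspace X \<inter> S = S" using assms by blast
  have "(subtopology X S) closure_of D = S \<longleftrightarrow>
      (\<forall>U x. openin X U \<and> x \<in> U \<inter> S \<longrightarrow> (\<exists>y\<in>D. y \<in> U))" if D: "D \<subseteq> S" for D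
  proof -
    have "(subtopology X S) closure_of D = S \<inter> X closure_of D"
      using D by (simp add: closure_of_subtopology Int_absorb1)
    then have "(subtopology X S) closure_of D = S \<longleftrightarrow> (\<forall>x\<in>S. x \<in> X closure_of D)" by auto
    also have "\<dots> \<longleftrightarrow> (\<forall>x\<in>S. \<forall>U. x \<in> U \<and> openin X U \<longrightarrow> (\<exists>y. y \<in> D \<and> y \<in> U))"
      using assms by (auto simp: in_closure_of)
    finally show ?thesis by blast
  qed
  then show ?thesis unfolding separable_space_def by (simp add: S cong: conj_cong)
qed

text \<open>Interiors of closures of subsets of a countable dense set form a base: an open
  \<open>V\<close> is contained in the closure of its trace on the dense set, and regularity keeps
  that closure inside \<open>U\<close>.\<close>

lemma separable_regular_base:
  assumes "separable_space X" "regular_space X"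
  shows "\<exists>\<N> :: nat set \<Rightarrow> 'a set. (\<forall>A. openin X (\<N> A)) \<and>
    (\<forall>U x. openin X U \<and> x \<in> U \<longrightarrow> (\<exists>A. x \<in> \<N> A \<and> \<N> A \<subseteq> U))"
proof -
  obtain D where D: "countable D" "D \<subseteq> topspace X" "X closure_of D = topspace X"
    using assms(1) by (auto simp: separable_space_def)
  define \<N> where "\<N> A = X interior_of (X closure_of (from_nat_into D ` A))" for A
  have "\<exists>A. x \<in> \<N> A \<and> \<N> A \<subseteq> U" if U: "openin X U" "x \<in> U" for U x
  proof -
    obtain V F where V: "openin X V" "closedin X F" "x \<in> V" "V \<subseteq> F" "F \<subseteq> U"
      using assms(2) U unfolding neighbourhood_base_of_closedin[symmetric] neighbourhood_base_of
      by metis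
    define A where "A = {n. from_nat_into D n \<in> V}"
    have "V \<inter> D \<subseteq> from_nat_into D ` A"
      using from_nat_into_surj[OF D(1)] by (fastforce simp: A_def image_iff)
    moreover have "V \<subseteq> X closure_of (V \<inter> D)"
      using V(1) D(3) openin_subset[OF V(1)] openin_Int_closure_of_subset[OF V(1), of D] by auto
    ultimately have "V \<subseteq> X closure_of (from_nat_into D ` A)" using closure_of_mono by blast
    then have "V \<subseteq> \<N> A" using V(1) by (simp add: \<N>_def interior_of_maximal)
    moreover have "X closure_of (from_nat_into D ` A) \<subseteq> F"
      using V by (intro closure_of_minimal) (auto simp: A_def)
    then have "\<N> A \<subseteq> F" unfolding \<N>_def by (rule order_trans[OF interior_of_subset])
    ultimately show ?thesis using V by blast
  qed
  moreover have "openin X (\<N> A)" for A by (simp add: \<N>_def)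
  ultimately show ?thesis by blast
qed

section \<open>Identity neighbourhoods and closed subgroups with second countable quotients\<close>

context hausdorff_group
begin

lemma exists_symmetric_neighbourhood:
  assumes "openin T W" "\<one> \<in> W"
  shows "\<exists>V. openin T V \<and> \<one> \<in> V \<and> (\<forall>v\<in>V. inv v \<in> V) \<and> V <#> V \<subseteq> W"
proof -
  let ?O = "{p \<in> topspace (prod_topology T T). (\<lambda>(x, y). x \<otimes> y) p \<in> W}"
  have "openin (prod_topology T T) ?O"
    using continuous_mult assms(1) by (rule openin_continuous_map_preimage)
  moreover have "(\<one>, \<one>) \<in> ?O" using assms(2) by simp
  ultimately obtain A B where AB: "openin T A" "openin T B" "\<one> \<in> A" "\<one> \<in> B" "A \<times> B \<subseteq> ?O"
    unfolding openin_prod_topology_alt by meson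
  define V where "V = A \<inter> B \<inter> {y \<in> topspace T. inv y \<in> A \<inter> B}"
  have "openin T V"
    unfolding V_def using AB by (intro openin_Int openin_continuous_map_preimage[OF continuous_inv])
  moreover have "\<one> \<in> V" using AB by (simp add: V_def)
  moreover have "\<forall>v\<in>V. inv v \<in> V" by (auto simp: V_def)
  moreover have "V <#> V \<subseteq> W"
  proof
    fix z assume "z \<in> V <#> V"
    then obtain a b where "a \<in> A" "b \<in> B" "z = a \<otimes> b" by (auto simp: V_def set_mult_def)
    then show "z \<in> W" using AB(5) by auto
  qed
  ultimately show ?thesis by blast
qed

text \<open>The construction of Kakutani and Kodaira, without asking for normality: \<open>N\<close>
  is the intersection of symmetric neighbourhoods \<open>V n\<close> with
  \<open>V (Suc n) <#> V (Suc n) \<subseteq> V n\<close>. Finitely many translates of each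
  \<open>V n\<close> cover the group, and all these translates together form the family
  \<open>B\<close>.\<close>

lemma closed_subgroup_with_second_countable_quotient:
  assumes compact: "compact_space T" and W: "openin T W" "\<one> \<in> W"
  shows "\<exists>N (B :: nat \<Rightarrow> 'a set). subgroup N G \<and> closedin T N \<and> N \<subseteq> W \<and> (\<forall>n. openin T (B n)) \<and>
    (\<forall>x U. x \<in> carrier G \<and> openin T U \<and> x <# N \<subseteq> U \<longrightarrow> (\<exists>n. x \<in> B n \<and> B n \<subseteq> U))"
proof -
  define P where "P V \<longleftrightarrow> openin T V \<and> \<one> \<in> V \<and> (\<forall>v\<in>V. inv v \<in> V) \<and> V \<subseteq> W" for V
  have one_sub: "V \<subseteq> V <#> V" if "\<one> \<in> V" "openin T V" for V
  proof
    fix v assume "v \<in> V"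
    moreover then have "v = v \<otimes> \<one>" using openin_carrier[OF that(2)] by auto
    ultimately show "v \<in> V <#> V" using that unfolding set_mult_def by blast
  qed
  have small: "\<exists>V'. P V' \<and> V' <#> V' \<subseteq> V" if V: "openin T V" "\<one> \<in> V" "V \<subseteq> W" for V
  proof -
    obtain V' where V': "openin T V'" "\<one> \<in> V'" "\<forall>v\<in>V'. inv v \<in> V'" "V' <#> V' \<subseteq> V"
      using exists_symmetric_neighbourhood[OF V(1,2)] by blast
    moreover have "V' \<subseteq> W" using one_sub[OF V'(2,1)] V'(4) V(3) by blast
    ultimately show ?thesis unfolding P_def by blast
  qed
  have "\<exists>V. \<forall>n. P (V n) \<and> V (Suc n) <#> V (Suc n) \<subseteq> V n"
  proof (rule dependent_nat_choice)
    show "\<exists>V. P V" using small[OF W] by blast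
    show "\<exists>V'. P V' \<and> V' <#> V' \<subseteq> V" if "P V" for V and n :: nat
      using small[of V] that by (simp add: P_def)
  qed
  then obtain V where V: "\<And>n. openin T (V n)" "\<And>n. \<one> \<in> V n" "\<And>n v. v \<in> V n \<Longrightarrow> inv v \<in> V n"
      "\<And>n. V n \<subseteq> W" and VV: "\<And>n. V (Suc n) <#> V (Suc n) \<subseteq> V n"
    unfolding P_def by metis
  have car: "V n \<subseteq> carrier G" for n using openin_carrier[OF V(1)] .
  have mult: "a \<otimes> b \<in> V n" if "a \<in> V (Suc n)" "b \<in> V (Suc n)" for a b n
    using that VV[of n] by (auto simp: set_mult_def)
  have Suc: "V (Suc n) \<subseteq> V n" for n using one_sub[OF V(2) V(1)] VV by blast
  \<comment> \<open>If \<open>y\<close> is in the closure, its neighbourhood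
    \<open>y <# V (Suc n)\<close> meets \<open>V (Suc n)\<close>, so \<open>y\<close> is a product
    of two elements of \<open>V (Suc n)\<close>. Hence \<open>N\<close> is also the intersection of
    the closures, and therefore closed.\<close>
  have cl: "T closure_of V (Suc n) \<subseteq> V n" for n
  proof
    fix y assume y: "y \<in> T closure_of V (Suc n)"
    then have yG: "y \<in> carrier G" using closure_of_subset_topspace by fastforce
    have "y \<in> y <# V (Suc n)" using yG V(2) car by (simp add: mem_l_coset_iff)
    then obtain z where z: "z \<in> V (Suc n)" "z \<in> y <# V (Suc n)"
      using y openin_l_coset[OF yG V(1)] unfolding in_closure_of by blast
    then obtain u where u: "u \<in> V (Suc n)" "z = y \<otimes> u" by (auto simp: l_coset_def)
    have "u \<in> carrier G" using u(1) car by blast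
    then have "y = z \<otimes> inv u" using u(2) yG by (simp add: m_assoc)
    then show "y \<in> V n" using mult[OF z(1) V(3)[OF u(1)]] by simp
  qed
  define N where "N = (\<Inter>n. V n)"
  have N_cl: "N = (\<Inter>n. T closure_of V n)"
  proof
    show "N \<subseteq> (\<Inter>n. T closure_of V n)"
      using closure_of_subset[of "V _" T] car unfolding N_def topspace_eq by blast
    show "(\<Inter>n. T closure_of V n) \<subseteq> N" using cl unfolding N_def by blast
  qed
  have "subgroup N G"
  proof (rule subgroupI)
    show "N \<subseteq> carrier G" using car by (auto simp: N_def)
    show "N \<noteq> {}" using V(2) by (auto simp: N_def)
    show "inv a \<in> N" if "a \<in> N" for a using that V(3) by (auto simp: N_def)
    show "a \<otimes> b \<in> N" if "a \<in> N" "b \<in> N" for a b using that mult by (auto simp: N_def)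
  qed
  moreover have "closedin T N" unfolding N_cl by (intro closedin_Inter) auto
  moreover have "N \<subseteq> W" using V(4) by (auto simp: N_def)
  moreover have "\<exists>Y. finite Y \<and> Y \<subseteq> carrier G \<and> carrier G \<subseteq> (\<Union>y\<in>Y. y <# V n)" for n
  proof -
    have "compactin T (carrier G)" using compact by (simp add: compact_space_def)
    moreover have "carrier G \<subseteq> \<Union>((\<lambda>y. y <# V n) ` carrier G)"
    proof
      fix y assume "y \<in> carrier G"
      moreover then have "y \<in> y <# V n" using V(2) car by (simp add: mem_l_coset_iff)
      ultimately show "y \<in> \<Union>((\<lambda>y. y <# V n) ` carrier G)" by blast
    qed
    moreover have "\<forall>S\<in>(\<lambda>y. y <# V n) ` carrier G. openin T S" using openin_l_coset V(1) by blast
    ultimately have "\<exists>\<F>. finite \<F> \<and> \<F> \<subseteq> (\<lambda>y. y <# V n) ` carrier G \<and> carrier G \<subseteq> \<Union>\<F>"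
      unfolding compactin_def by blast
    then obtain \<F> where F: "finite \<F>" "\<F> \<subseteq> (\<lambda>y. y <# V n) ` carrier G" "carrier G \<subseteq> \<Union>\<F>"
      by blast
    from finite_subset_image[OF F(1,2)] F(3) show ?thesis by blast
  qed
  then obtain Y where Y: "\<And>n. finite (Y n)" "\<And>n. Y n \<subseteq> carrier G"
      "\<And>n. carrier G \<subseteq> (\<Union>y\<in>Y n. y <# V n)"
    by metis
  define \<B> where "\<B> = (\<Union>n. (\<lambda>y. y <# V n) ` Y n)"
  have "countable \<B>" using Y(1) by (auto simp: \<B>_def countable_finite)
  have "Y 0 \<noteq> {}" using Y(3)[of 0] one_closed by auto
  then have "\<B> \<noteq> {}" by (auto simp: \<B>_def)
  have "openin T S" if "S \<in> \<B>" for S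
    using that openin_l_coset[OF subsetD[OF Y(2)] V(1)] by (auto simp: \<B>_def)
  then have "\<forall>n. openin T (from_nat_into \<B> n)" using from_nat_into[OF \<open>\<B> \<noteq> {}\<close>] by blast
  moreover have "\<exists>n. x \<in> from_nat_into \<B> n \<and> from_nat_into \<B> n \<subseteq> U"
    if x: "x \<in> carrier G" and U: "openin T U" "x <# N \<subseteq> U" for x U
  proof -
    \<comment> \<open>Otherwise the closed sets \<open>C n\<close> decrease and are nonempty, and by
      compactness a common point would lie in \<open>x <# N\<close> but outside
      \<open>U\<close>.\<close>
    have "\<exists>n. x <# (T closure_of V n) \<subseteq> U"
    proof (rule ccontr)
      assume *: "\<not> ?thesis"
      define C where "C n = (x <# (T closure_of V n)) - U" for n
      have "(\<Inter>n. C n) \<noteq> {}"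
      proof (rule compact_space_imp_nest[OF compact])
        show "closedin T (C n)" for n
          unfolding C_def using x U by (intro closedin_diff closedin_l_coset) auto
        show "C n \<noteq> {}" for n using * by (auto simp: C_def)
        show "decseq C"
          unfolding C_def decseq_Suc_iff using closure_of_mono[OF Suc] by (auto simp: l_coset_def)
      qed
      then obtain y where y: "\<And>n. y \<in> C n" by blast
      have "T closure_of V n \<subseteq> carrier G" for n using closure_of_subset_topspace[of T] by simp
      then have "y \<in> carrier G" "inv x \<otimes> y \<in> T closure_of V n" for n
        using y[of n] x by (auto simp: C_def mem_l_coset_iff)
      then have "inv x \<otimes> y \<in> N" unfolding N_cl by blast
      moreover have "N \<subseteq> carrier G" using car by (auto simp: N_def)
      ultimately have "y \<in> x <# N" using x \<open>y \<in> carrier G\<close> by (simp add: mem_l_coset_iff)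
      then show False using U y[of 0] by (auto simp: C_def)
    qed
    then obtain n where n: "x <# (T closure_of V n) \<subseteq> U" by blast
    moreover have "V n \<subseteq> T closure_of V n" using car by (simp add: closure_of_subset)
    ultimately have xV: "x <# V n \<subseteq> U" by (auto simp: l_coset_def)
    \<comment> \<open>The index \<open>Suc n\<close> leaves room for one multiplication: two points
      of the same translate of \<open>V (Suc n)\<close> differ by an element of
      \<open>V n\<close>.\<close>
    obtain y where y: "y \<in> Y (Suc n)" "x \<in> y <# V (Suc n)" using Y(3) x by blast
    have yG: "y \<in> carrier G" using y(1) Y(2) by blast
    have "y <# V (Suc n) \<subseteq> x <# V n"
    proof
      fix z assume z: "z \<in> y <# V (Suc n)"
      have zG: "z \<in> carrier G" using z yG car by (simp add: mem_l_coset_iff)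
      have "inv (inv y \<otimes> x) \<otimes> (inv y \<otimes> z) \<in> V n"
        by (rule mult[OF V(3)]) (use y(2) z yG car in \<open>simp_all add: mem_l_coset_iff\<close>)
      moreover have "inv (inv y \<otimes> x) \<otimes> (inv y \<otimes> z) = inv x \<otimes> (y \<otimes> (inv y \<otimes> z))"
        using x yG zG by (simp add: inv_mult_group m_assoc)
      moreover have "y \<otimes> (inv y \<otimes> z) = z" using yG zG by (simp add: m_assoc[symmetric])
      ultimately show "z \<in> x <# V n" using x zG car by (simp add: mem_l_coset_iff)
    qed
    moreover obtain k where "from_nat_into \<B> k = y <# V (Suc n)"
      using from_nat_into_surj[OF \<open>countable \<B>\<close>, of "y <# V (Suc n)"] y(1) by (auto simp: \<B>_def)
    ultimately show ?thesis using y(2) xV by blast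
  qed
  ultimately show ?thesis by blast
qed

text \<open>Each basic neighbourhood of \<open>\<one>\<close> contains a subgroup
  \<open>N i\<close>, so these intersect trivially by the Hausdorff property. The indices are
  themselves sets of naturals, so \<open>id\<close> is the required injection.\<close>

lemma compact_group_separable:
  fixes \<N> :: "nat set \<Rightarrow> 'a set"
  assumes compact: "compact_space T" and open_base: "\<And>i. openin T (\<N> i)"
    and base: "\<And>U. openin T U \<Longrightarrow> \<one> \<in> U \<Longrightarrow> \<exists>i. \<one> \<in> \<N> i \<and> \<N> i \<subseteq> U"
  shows "separable_space T"
proof -
  have "\<exists>N (B :: nat \<Rightarrow> 'a set). subgroup N G \<and> closedin T N \<and> (\<one> \<in> \<N> i \<longrightarrow> N \<subseteq> \<N> i) \<and>
    (\<forall>n. openin T (B n)) \<and>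
    (\<forall>x U. x \<in> carrier G \<and> openin T U \<and> x <# N \<subseteq> U \<longrightarrow> (\<exists>n. x \<in> B n \<and> B n \<subseteq> U))" for i
  proof (cases "\<one> \<in> \<N> i")
    case True
    then show ?thesis
      using closed_subgroup_with_second_countable_quotient[OF compact open_base] by simp
  next
    \<comment> \<open>Such an index imposes no smallness condition; it gets a subgroup for
      \<open>W = carrier G\<close> as a default.\<close>
    case False
    then show ?thesis
      using closed_subgroup_with_second_countable_quotient[OF compact openin_carrier_self] by auto
  qed
  then obtain N B where NB: "\<And>i. subgroup (N i) G" "\<And>i. closedin T (N i)"
    "\<And>i. \<one> \<in> \<N> i \<Longrightarrow> N i \<subseteq> \<N> i" "\<And>i n. openin T ((B :: nat set \<Rightarrow> nat \<Rightarrow> 'a set) i n)"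
    "\<And>i x U. x \<in> carrier G \<and> openin T U \<and> x <# N i \<subseteq> U \<longrightarrow> (\<exists>n. x \<in> B i n \<and> B i n \<subseteq> U)"
    by metis
  obtain R :: "nat set rel" where R: "well_order_on UNIV R" using well_order_on by blast
  then have wo: "wf (R - Id)" "trans (R - Id)" "total (R - Id)"
    by (auto simp: well_order_on_def linear_order_on_def partial_order_on_def preorder_on_def
        trans_diff_Id)
  interpret subgroup_tower G T "R - Id" N B
  proof (intro subgroup_tower.intro subgroup_tower_axioms.intro)
    show "hausdorff_group G T" by (rule hausdorff_group_axioms)
    show "subgroup (N i) G" "closedin T (N i)" "openin T (B i n)" for i n by (rule NB)+
    show "\<exists>n. x \<in> B i n \<and> B i n \<subseteq> U"
      if "x \<in> carrier G" "openin T U" "x <# N i \<subseteq> U" for i x U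
      using NB(5) that by simp
  qed (fact compact wo)+
  have "(\<Inter>i. N i) \<subseteq> {\<one>}"
  proof
    fix z assume z: "z \<in> (\<Inter>i. N i)"
    show "z \<in> {\<one>}"
    proof (rule ccontr)
      assume "z \<notin> {\<one>}"
      have "z \<in> carrier G" using z N_carrier by blast
      then have "openin T (carrier G - {z})"
        using closedin_Hausdorff_sing_eq[OF Hausdorff, of z] by (simp add: openin_diff)
      then obtain i where "\<one> \<in> \<N> i" "\<N> i \<subseteq> carrier G - {z}" using base \<open>z \<notin> {\<one>}\<close> by blast
      then show False using NB(3)[of i] z by blast
    qed
  qed
  then show ?thesis by (intro separable_if_trivial_intersection[of id]) auto
qed

end

section \<open>Closed subgroups inside a separable compact set\<close>

lemma topological_group_subgroup:
  assumes "topological_group G T" "subgroup M G"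
  shows "topological_group (G\<lparr>carrier := M\<rparr>) (subtopology T M)"
proof -
  interpret hausdorff_group G T by (rule hausdorff_group.intro) fact
  have M: "M \<subseteq> carrier G" using assms(2) by (rule subgroup.subset)
  have "continuous_map (prod_topology (subtopology T M) (subtopology T M)) (subtopology T M)
      (\<lambda>(x, y). x \<otimes>\<^bsub>G\<^esub> y)"
    using continuous_map_from_subtopology[OF continuous_mult, of "M \<times> M"] subgroup.m_closed[OF assms(2)]
    by (auto simp: continuous_map_in_subtopology subtopology_Times)
  moreover have "continuous_map (subtopology T M) (subtopology T M) (\<lambda>x. inv\<^bsub>G\<^esub> x)"
    using continuous_map_from_subtopology[OF continuous_inv, of M] subgroup.m_inv_closed[OF assms(2)]
    by (auto simp: continuous_map_in_subtopology)
  then have "continuous_map (subtopology T M) (subtopology T M) (\<lambda>x. inv\<^bsub>G\<lparr>carrier := M\<rparr>\<^esub> x)"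
    by (rule continuous_map_eq) (auto simp: m_inv_consistent[OF assms(2)])
  moreover have "group (G\<lparr>carrier := M\<rparr>)"
    using assms(2) by (rule subgroup.subgroup_is_group) (rule is_group)
  ultimately show ?thesis
    using M Hausdorff by (auto simp: topological_group_def Hausdorff_space_subtopology)
qed

text \<open>Separability need not pass to closed subspaces, but a base indexed by sets of naturals
  does: its traces on \<open>M\<close> are what \<open>compact_group_separable\<close>
  needs.\<close>

lemma separable_subgroup_of_compact_separable:
  fixes G (structure)
  assumes G: "topological_group G T" and K: "compactin T K" "separable_space (subtopology T K)"
    and M: "subgroup M G" "closedin T M" "M \<subseteq> K"
  shows "separable_space (subtopology T M)"
proof -
  interpret hausdorff_group G T by (rule hausdorff_group.intro) fact
  interpret M: hausdorff_group "G\<lparr>carrier := M\<rparr>" "subtopology T M"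
    by (rule hausdorff_group.intro) (rule topological_group_subgroup[OF G M(1)])
  have "compact_space (subtopology T K)" using K(1) by (rule compact_space_subtopology)
  then have "regular_space (subtopology T K)"
    using Hausdorff_space_subtopology[OF Hausdorff] compact_Hausdorff_imp_regular_space by blast
  from separable_regular_base[OF K(2) this] obtain \<N> :: "nat set \<Rightarrow> 'a set"
    where N: "\<forall>A. openin (subtopology T K) (\<N> A)"
      "\<forall>U x. openin (subtopology T K) U \<and> x \<in> U \<longrightarrow> (\<exists>A. x \<in> \<N> A \<and> \<N> A \<subseteq> U)"
    by blast
  have KM: "K \<inter> M = M" using M(3) by blast
  have restrict: "openin (subtopology T M) (U \<inter> M)" if "openin (subtopology T K) U" for U
    using openin_subtopology_Int[OF that, of M] by (simp add: subtopology_subtopology KM)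
  show ?thesis
  proof (rule M.compact_group_separable[of "\<lambda>A. \<N> A \<inter> M"])
    show "compact_space (subtopology T M)"
      using closed_compactin[OF K(1) M(3,2)] by (rule compact_space_subtopology)
    show "openin (subtopology T M) (\<N> A \<inter> M)" for A using restrict N(1) by blast
    fix U assume U: "openin (subtopology T M) U" "\<one>\<^bsub>G\<lparr>carrier := M\<rparr>\<^esub> \<in> U"
    then obtain W where W: "openin T W" "U = W \<inter> M" by (auto simp: openin_subtopology)
    have "openin (subtopology T K) (W \<inter> K)" using W(1) by (auto simp: openin_subtopology)
    moreover have "\<one> \<in> W \<inter> K" using U(2) W(2) M(3) by auto
    ultimately obtain A where "\<one> \<in> \<N> A" "\<N> A \<subseteq> W \<inter> K" using N(2) by blast
    then show "\<exists>A. \<one>\<^bsub>G\<lparr>carrier := M\<rparr>\<^esub> \<in> \<N> A \<inter> M \<and> \<N> A \<inter> M \<subseteq> U"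
      using U(2) W(2) by auto
  qed
qed

section \<open>Closed subgroups of products\<close>

lemma topological_group_DirProd:
  assumes "topological_group G T" "topological_group H U"
  shows "topological_group (G \<times>\<times> H) (prod_topology T U)"
proof -
  interpret G: hausdorff_group G T by (rule hausdorff_group.intro) fact
  interpret H: hausdorff_group H U by (rule hausdorff_group.intro) fact
  let ?P = "prod_topology T U"
  have "continuous_map (prod_topology ?P ?P) ?P
      (\<lambda>p. (fst (fst p) \<otimes>\<^bsub>G\<^esub> fst (snd p), snd (fst p) \<otimes>\<^bsub>H\<^esub> snd (snd p)))"
    using continuous_map_compose[OF continuous_map_fst[of ?P ?P] continuous_map_fst[of T U]]
      continuous_map_compose[OF continuous_map_snd[of ?P ?P] continuous_map_fst[of T U]]
      continuous_map_compose[OF continuous_map_fst[of ?P ?P] continuous_map_snd[of T U]]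
      continuous_map_compose[OF continuous_map_snd[of ?P ?P] continuous_map_snd[of T U]]
    by (intro continuous_map_pairedI G.continuous_map_mult H.continuous_map_mult) (simp_all add: o_def)
  then have "continuous_map (prod_topology ?P ?P) ?P (\<lambda>(x, y). x \<otimes>\<^bsub>G \<times>\<times> H\<^esub> y)"
    by (simp add: case_prod_unfold mult_DirProd')
  moreover have "continuous_map ?P ?P (\<lambda>p. (inv\<^bsub>G\<^esub> fst p, inv\<^bsub>H\<^esub> snd p))"
    using continuous_map_compose[OF continuous_map_fst[of T U] G.continuous_inv]
      continuous_map_compose[OF continuous_map_snd[of T U] H.continuous_inv]
    by (intro continuous_map_pairedI) (simp_all add: o_def)
  then have "continuous_map ?P ?P (\<lambda>x. inv\<^bsub>G \<times>\<times> H\<^esub> x)"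
    by (rule continuous_map_eq) (auto simp: inv_DirProd[OF G.is_group H.is_group])
  ultimately show ?thesis
    unfolding topological_group_def
    using DirProd_group[OF G.is_group H.is_group] G.Hausdorff H.Hausdorff
    by (simp add: Hausdorff_space_prod_topology)
qed

text \<open>The products of an element of \<open>A\<close> with an element of a dense subset of
  \<open>S0\<close> are dense in \<open>S\<close>: translation by \<open>inv a\<close> carries an
  open set meeting \<open>a <# S0\<close> to one meeting \<open>S0\<close>.\<close>

lemma separable_of_countable_index:
  fixes G (structure)
  assumes "topological_group G T" and S: "subgroup S G" and S0: "S0 \<subseteq> S"
    and sep: "separable_space (subtopology T S0)"
    and A: "countable A" "A \<subseteq> S" "S \<subseteq> (\<Union>a\<in>A. a <#\<^bsub>G\<^esub> S0)"
  shows "separable_space (subtopology T S)"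
proof -
  interpret hausdorff_group G T by (rule hausdorff_group.intro) fact
  have SG: "S \<subseteq> carrier G" using S by (rule subgroup.subset)
  have S0G: "S0 \<subseteq> carrier G" using S0 SG by blast
  obtain D where D: "countable D" "D \<subseteq> S0"
    and dense: "\<forall>U x. openin T U \<and> x \<in> U \<inter> S0 \<longrightarrow> (\<exists>y\<in>D. y \<in> U)"
    using iffD1[OF separable_subtopology_iff sep] S0G by auto
  define E where "E = (\<lambda>(a, d). a \<otimes> d) ` (A \<times> D)"
  have "countable E" using A(1) D(1) by (simp add: E_def)
  moreover have "E \<subseteq> S"
    using A(2) D(2) S0 by (auto simp: E_def intro!: subgroup.m_closed[OF S])
  moreover have "\<exists>y\<in>E. y \<in> U" if U: "openin T U" "x \<in> U \<inter> S" for U x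
  proof -
    obtain a where a: "a \<in> A" "x \<in> a <# S0" using A(3) U by blast
    have aG: "a \<in> carrier G" using a(1) A(2) SG by blast
    have "inv a \<otimes> x \<in> S0" using a(2) aG S0G by (simp add: mem_l_coset_iff)
    moreover have "inv a \<otimes> x \<in> inv a <# U" using U by (auto simp: l_coset_def)
    moreover have "openin T (inv a <# U)" using aG U by (intro openin_l_coset) auto
    ultimately obtain d where d: "d \<in> D" "d \<in> inv a <# U" using dense by blast
    then have "a \<otimes> d \<in> U" using aG openin_carrier[OF U(1)] by (simp add: mem_l_coset_iff)
    then show ?thesis using a(1) d(1) by (auto simp: E_def)
  qed
  ultimately show ?thesis
    using separable_subtopology_iff[of S T] SG by auto
qed

text \<open>Since \<open>F\<close> lies over the compact set \<open>K\<close>, it is closed in a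
  product with a compact factor, along which projection is a closed map.\<close>

lemma closedin_snd_image:
  assumes "compactin X K" "closedin (prod_topology X Y) F" "F \<subseteq> K \<times> topspace Y"
  shows "closedin Y (snd ` F)"
proof -
  have "closedin (subtopology (prod_topology X Y) (K \<times> topspace Y)) F"
    using assms(2,3) by (metis closedin_subset_topspace)
  then have "closedin (prod_topology (subtopology X K) Y) F"
    using subtopology_Times[of X Y K "topspace Y"] by simp
  then show ?thesis
    using closed_map_snd[OF compact_space_subtopology[OF assms(1)], of Y] by (simp add: closed_map_def)
qed

text \<open>The projection of \<open>S\<close> to \<open>H\<close> has compact kernel, so it is a closed and hence open map onto
  its image; separability then lifts from the kernel and the image.\<close>

lemma separable_closed_subgroup_over_compact:
  assumes G: "topological_group G T" and H: "topological_group H U"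
    and K: "subgroup K G" "compactin T K" "separable_space (subtopology T K)"
    and sepH: "closed_subgroups_separable H U"
    and S: "subgroup S (G \<times>\<times> H)" "closedin (prod_topology T U) S" "S \<subseteq> K \<times> carrier H"
  shows "separable_space (subtopology (prod_topology T U) S)"
proof -
  interpret G: hausdorff_group G T by (rule hausdorff_group.intro) fact
  interpret H: hausdorff_group H U by (rule hausdorff_group.intro) fact
  interpret P: hausdorff_group "G \<times>\<times> H" "prod_topology T U"
    by (rule hausdorff_group.intro) (rule topological_group_DirProd[OF G H])
  let ?P = "prod_topology T U"
  have KG: "K \<subseteq> carrier G" using K(1) by (rule subgroup.subset)
  have inv_P: "inv\<^bsub>G \<times>\<times> H\<^esub> (g, h) = (inv\<^bsub>G\<^esub> g, inv\<^bsub>H\<^esub> h)"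
    if "g \<in> carrier G" "h \<in> carrier H" for g h
    using that by (rule inv_DirProd[OF G.is_group H.is_group])
  define M where "M = {g \<in> carrier G. (g, \<one>\<^bsub>H\<^esub>) \<in> S}"
  have MK: "M \<subseteq> K" using S(3) by (auto simp: M_def)
  have M: "subgroup M G"
  proof (rule G.subgroupI)
    show "M \<noteq> {}" using subgroup.one_closed[OF S(1)] by (auto simp: M_def)
    show "inv\<^bsub>G\<^esub> a \<in> M" if "a \<in> M" for a
      using that subgroup.m_inv_closed[OF S(1), of "(a, \<one>\<^bsub>H\<^esub>)"] by (simp add: M_def inv_P)
    show "a \<otimes>\<^bsub>G\<^esub> b \<in> M" if "a \<in> M" "b \<in> M" for a b
      using that subgroup.m_closed[OF S(1), of "(a, \<one>\<^bsub>H\<^esub>)" "(b, \<one>\<^bsub>H\<^esub>)"] by (simp add: M_def)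
  qed (auto simp: M_def)
  have "continuous_map T ?P (\<lambda>g. (g, \<one>\<^bsub>H\<^esub>))" by (intro continuous_map_pairedI) auto
  from closedin_continuous_map_preimage[OF this S(2)] have "closedin T M" by (simp add: M_def)
  from separable_subgroup_of_compact_separable[OF G K(2,3) M this MK]
  have "separable_space (subtopology T M)" .
  from iffD1[OF separable_subtopology_iff this] obtain D where D: "countable D" "D \<subseteq> M"
    and denseD: "\<forall>W x. openin T W \<and> x \<in> W \<inter> M \<longrightarrow> (\<exists>y\<in>D. y \<in> W)"
    using MK KG by auto
  define Q where "Q = snd ` S"
  have "closedin U Q" unfolding Q_def using K(2) S(2,3) by (intro closedin_snd_image) auto
  moreover have "subgroup Q H"
  proof (rule H.subgroupI)
    show "Q \<subseteq> carrier H" using S(3) by (auto simp: Q_def)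
    show "Q \<noteq> {}" using subgroup.one_closed[OF S(1)] by (auto simp: Q_def)
    show "inv\<^bsub>H\<^esub> a \<in> Q" if a: "a \<in> Q" for a
    proof -
      obtain g where g: "(g, a) \<in> S" using a by (auto simp: Q_def)
      then have "inv\<^bsub>G \<times>\<times> H\<^esub> (g, a) = (inv\<^bsub>G\<^esub> g, inv\<^bsub>H\<^esub> a)" using S(3) KG by (intro inv_P) auto
      then have "(inv\<^bsub>G\<^esub> g, inv\<^bsub>H\<^esub> a) \<in> S" using subgroup.m_inv_closed[OF S(1) g] by simp
      then show ?thesis by (force simp: Q_def)
    qed
    show "a \<otimes>\<^bsub>H\<^esub> b \<in> Q" if ab: "a \<in> Q" "b \<in> Q" for a b
    proof -
      obtain g h where "(g, a) \<in> S" "(h, b) \<in> S" using ab by (auto simp: Q_def)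
      from subgroup.m_closed[OF S(1) this] show ?thesis by (force simp: Q_def)
    qed
  qed
  ultimately have "separable_space (subtopology U Q)" using sepH by (simp add: closed_subgroups_separable_def)
  from iffD1[OF separable_subtopology_iff this] obtain E where E: "countable E" "E \<subseteq> Q"
    and denseE: "\<forall>W x. openin U W \<and> x \<in> W \<inter> Q \<longrightarrow> (\<exists>y\<in>E. y \<in> W)"
    using closedin_subset[OF \<open>closedin U Q\<close>] by auto
  have "\<exists>g. (g, h) \<in> S" if "h \<in> E" for h using that E(2) by (force simp: Q_def)
  then obtain s where s: "\<And>h. h \<in> E \<Longrightarrow> (s h, h) \<in> S" by metis
  \<comment> \<open>The fibre of \<open>S\<close> over \<open>h\<close> is the coset of
    \<open>M\<close> with representative \<open>s h\<close>, so translating \<open>D\<close> by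
    \<open>s h\<close> gives a dense subset of that fibre.\<close>
  define Z where "Z = (\<lambda>(h, d). (s h \<otimes>\<^bsub>G\<^esub> d, h)) ` (E \<times> D)"
  have "countable Z" using E(1) D(1) by (simp add: Z_def)
  moreover have "Z \<subseteq> S"
  proof
    fix z assume "z \<in> Z"
    then obtain h d where z: "h \<in> E" "d \<in> D" "z = (s h \<otimes>\<^bsub>G\<^esub> d, h)" by (auto simp: Z_def)
    have "(d, \<one>\<^bsub>H\<^esub>) \<in> S" using z D by (auto simp: M_def)
    moreover have "h \<in> carrier H" using s[OF z(1)] S(3) by auto
    ultimately show "z \<in> S" using subgroup.m_closed[OF S(1) s[OF z(1)], of "(d, \<one>\<^bsub>H\<^esub>)"] z(3) by simp
  qed
  moreover have "\<exists>y\<in>Z. y \<in> W" if W: "openin ?P W" "z \<in> W \<inter> S" for W z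
  proof -
    define N where "N = M \<times> {\<one>\<^bsub>H\<^esub>}"
    \<comment> \<open>The part of \<open>S\<close> outside the saturation of \<open>W\<close> by the
      kernel \<open>N\<close>. Its image in \<open>H\<close> is closed and misses
      \<open>snd z\<close>, because all points of \<open>S\<close> over \<open>snd z\<close> differ
      from \<open>z\<close> by elements of \<open>N\<close>.\<close>
    define F where "F = S - (W <#>\<^bsub>G \<times>\<times> H\<^esub> N)"
    have "openin ?P (W <#>\<^bsub>G \<times>\<times> H\<^esub> N)"
      using W(1) MK KG by (intro P.openin_set_mult) (auto simp: N_def)
    then have "closedin ?P F" unfolding F_def using S(2) by (intro closedin_diff)
    then have "closedin U (snd ` F)" using K(2) S(3) by (intro closedin_snd_image) (auto simp: F_def)
    then have "openin U (carrier H - snd ` F)" by (intro openin_diff) auto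
    moreover have "snd z \<in> (carrier H - snd ` F) \<inter> Q"
    proof -
      have "snd z \<notin> snd ` F"
      proof
        assume "snd z \<in> snd ` F"
        then obtain f where f: "f \<in> F" "snd z = snd f" by auto
        obtain g h g' where zf: "z = (g, h)" "f = (g', h)" using f(2) by (cases z, cases f) auto
        have fS: "(g', h) \<in> S" "(g, h) \<in> S" using f(1) W(2) zf by (auto simp: F_def)
        then have car: "g \<in> carrier G" "g' \<in> carrier G" "h \<in> carrier H" using S(3) KG by auto
        have "(inv\<^bsub>G\<^esub> g, inv\<^bsub>H\<^esub> h) \<in> S"
          using subgroup.m_inv_closed[OF S(1) fS(2)] inv_P car by simp
        from subgroup.m_closed[OF S(1) this fS(1)]
        have "(inv\<^bsub>G\<^esub> g \<otimes>\<^bsub>G\<^esub> g', \<one>\<^bsub>H\<^esub>) \<in> N" using car by (simp add: N_def M_def)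
        moreover have "f = z \<otimes>\<^bsub>G \<times>\<times> H\<^esub> (inv\<^bsub>G\<^esub> g \<otimes>\<^bsub>G\<^esub> g', \<one>\<^bsub>H\<^esub>)"
          using car zf by (simp add: G.m_assoc[symmetric])
        ultimately have "f \<in> W <#>\<^bsub>G \<times>\<times> H\<^esub> N" using W(2) unfolding set_mult_def by blast
        then show False using f(1) by (simp add: F_def)
      qed
      then show ?thesis using W(2) S(3) by (auto simp: Q_def)
    qed
    ultimately obtain h where h: "h \<in> E" "h \<notin> snd ` F" using denseE by blast
    then have "(s h, h) \<in> W <#>\<^bsub>G \<times>\<times> H\<^esub> N" using s[OF h(1)] by (force simp: F_def)
    then obtain w m where w: "w \<in> W" "m \<in> M" "(s h, h) = w \<otimes>\<^bsub>G \<times>\<times> H\<^esub> (m, \<one>\<^bsub>H\<^esub>)"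
      by (auto simp: set_mult_def N_def)
    obtain a b where ab: "w = (a, b)" by (cases w)
    have car: "a \<in> carrier G" "b \<in> carrier H" "m \<in> carrier G" "s h \<in> carrier G" "h \<in> carrier H"
      using w(1,2) ab P.openin_carrier[OF W(1)] s[OF h(1)] S(3) KG by (auto simp: M_def)
    have "s h = a \<otimes>\<^bsub>G\<^esub> m" "h = b" using w(3) ab car by auto
    \<comment> \<open>The fibre over \<open>h\<close> therefore meets \<open>W\<close> at a
      translate of \<open>inv m\<close>, an element of \<open>M\<close>, and density of
      \<open>D\<close> in \<open>M\<close> replaces \<open>inv m\<close> by some
      \<open>d\<close>.\<close>
    then have "(s h \<otimes>\<^bsub>G\<^esub> inv\<^bsub>G\<^esub> m, h) \<in> W" using w(1) ab car by (simp add: G.m_assoc)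
    moreover have "continuous_map T ?P (\<lambda>g. (s h \<otimes>\<^bsub>G\<^esub> g, h))"
      using car by (intro continuous_map_pairedI G.continuous_l_translation) auto
    from openin_continuous_map_preimage[OF this W(1)]
    have "openin T {g \<in> carrier G. (s h \<otimes>\<^bsub>G\<^esub> g, h) \<in> W}" by simp
    moreover have "inv\<^bsub>G\<^esub> m \<in> M" using subgroup.m_inv_closed[OF M w(2)] .
    ultimately obtain d where "d \<in> D" "(s h \<otimes>\<^bsub>G\<^esub> d, h) \<in> W"
      using denseD[rule_format, of "{g \<in> carrier G. (s h \<otimes>\<^bsub>G\<^esub> g, h) \<in> W}" "inv\<^bsub>G\<^esub> m"] car by auto
    then show ?thesis using h(1) by (force simp: Z_def)
  qed
  ultimately show ?thesis
    using separable_subtopology_iff[of S ?P] closedin_subset[OF S(2)] by auto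
qed

section \<open>Reduction to the part of a closed subgroup lying over \<open>K\<close>\<close>

theorem theorem2p5:
  fixes G :: "('a, 'm) monoid_scheme" and T :: "'a topology" and K :: "'a set"
  assumes "topological_group G T"
    and "subgroup K G"
    and "compactin T K"
    and "separable_space (subtopology T K)"
    and "countable (lcosets\<^bsub>G\<^esub> K)"
  shows "S_separable TYPE('h) G T"
proof -
  interpret G: hausdorff_group G T by (rule hausdorff_group.intro) fact
  have KG: "K \<subseteq> carrier G" using assms(2) by (rule subgroup.subset)
  have "separable_space (subtopology (prod_topology T U) S)"
    if H: "topological_group H U" "closed_subgroups_separable H U"
      and S: "subgroup S (G \<times>\<times> H)" "closedin (prod_topology T U) S"
    for H :: "'h monoid" and U S
  proof -
    interpret H: hausdorff_group H U by (rule hausdorff_group.intro) fact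
    interpret P: hausdorff_group "G \<times>\<times> H" "prod_topology T U"
      by (rule hausdorff_group.intro) (rule topological_group_DirProd[OF assms(1) H(1)])
    let ?P = "G \<times>\<times> H"
    have SP: "S \<subseteq> carrier G \<times> carrier H" using subgroup.subset[OF S(1)] by simp
    define S0 where "S0 = S \<inter> (K \<times> carrier H)"
    have "subgroup S0 ?P"
      unfolding S0_def using S(1) DirProd_subgroups[OF G.is_group assms(2) H.is_group H.subgroup_self]
      by (rule P.subgroups_Inter_pair)
    moreover have "closedin (prod_topology T U) (K \<times> carrier H)"
      using compactin_imp_closedin[OF G.Hausdorff assms(3)] by (simp add: closedin_prod_Times_iff)
    then have "closedin (prod_topology T U) S0" unfolding S0_def using S(2) by (intro closedin_Int)
    ultimately have sep: "separable_space (subtopology (prod_topology T U) S0)"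
      using separable_closed_subgroup_over_compact[OF assms(1) H(1) assms(2-4) H(2), of S0]
      by (simp add: S0_def)
    \<comment> \<open>Only cosets met by first coordinates of \<open>S\<close> receive a
      representative, chosen in \<open>S\<close> itself, so that the quotient of a point of
      \<open>S\<close> by it stays in \<open>S\<close> while its first coordinate falls into
      \<open>K\<close>.\<close>
    define I where "I = {X \<in> lcosets\<^bsub>G\<^esub> K. \<exists>p\<in>S. fst p \<in> X}"
    have "\<forall>X\<in>I. \<exists>p. p \<in> S \<and> fst p \<in> X" by (auto simp: I_def)
    then obtain r where r: "\<And>X. X \<in> I \<Longrightarrow> r X \<in> S \<and> fst (r X) \<in> X" by metis
    have "countable I" using assms(5) by (simp add: I_def)
    moreover have "S \<subseteq> (\<Union>a\<in>r ` I. a <#\<^bsub>?P\<^esub> S0)"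
    proof
      fix p assume p: "p \<in> S"
      let ?X = "fst p <#\<^bsub>G\<^esub> K"
      have pG: "fst p \<in> carrier G" "snd p \<in> carrier H" using p SP by auto
      have "?X \<in> I" using p pG G.lcos_self[OF pG(1) assms(2)] by (auto simp: I_def LCOSETS_def)
      then have rX: "r ?X \<in> S" "fst (r ?X) \<in> ?X" using r by auto
      have rG: "fst (r ?X) \<in> carrier G" "snd (r ?X) \<in> carrier H" using rX SP by auto
      have "fst (r ?X) <#\<^bsub>G\<^esub> K = ?X" using G.l_repr_independence[OF rX(2) pG(1) assms(2)] by simp
      then have "fst p \<in> fst (r ?X) <#\<^bsub>G\<^esub> K" using G.lcos_self[OF pG(1) assms(2)] by simp
      then have "inv\<^bsub>G\<^esub> fst (r ?X) \<otimes>\<^bsub>G\<^esub> fst p \<in> K" using rG KG by (simp add: G.mem_l_coset_iff)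
      moreover have "inv\<^bsub>?P\<^esub> r ?X = (inv\<^bsub>G\<^esub> fst (r ?X), inv\<^bsub>H\<^esub> snd (r ?X))"
        using inv_DirProd[OF G.is_group H.is_group rG] by simp
      moreover have "inv\<^bsub>?P\<^esub> r ?X \<otimes>\<^bsub>?P\<^esub> p \<in> S"
        using subgroup.m_closed[OF S(1) subgroup.m_inv_closed[OF S(1) rX(1)] p] .
      ultimately have "inv\<^bsub>?P\<^esub> r ?X \<otimes>\<^bsub>?P\<^esub> p \<in> S0"
        using rG pG by (simp add: S0_def mult_DirProd')
      moreover have "r ?X \<in> carrier ?P" "p \<in> carrier ?P" "S0 \<subseteq> carrier ?P"
        using rX(1) p SP by (auto simp: S0_def)
      ultimately have "p \<in> r ?X <#\<^bsub>?P\<^esub> S0" using P.mem_l_coset_iff by blast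
      then show "p \<in> (\<Union>a\<in>r ` I. a <#\<^bsub>?P\<^esub> S0)" using \<open>?X \<in> I\<close> by blast
    qed
    moreover have "r ` I \<subseteq> S" using r by blast
    ultimately show ?thesis
      by (intro separable_of_countable_index[OF P.topological_group S(1) _ sep, of "r ` I"])
        (auto simp: S0_def)
  qed
  then have "closed_subgroups_separable (G \<times>\<times> H) (prod_topology T U)"
    if "topological_group H U" "closed_subgroups_separable H U" for H :: "'h monoid" and U
    using that unfolding closed_subgroups_separable_def[of "G \<times>\<times> H"] by blast
  then show ?thesis using assms(1) unfolding S_separable_def by blast
qed

end
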